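(* If a class $\mathcal{C}$ of graphs is monotone (closed under taking subgraphs) and somewhere dense (i.e., not nowhere dense), then $\mathcal{C}$ does not admit sparse neighbourhood covers.
   Context: All graphs are finite and simple. The length of a path is its number of edges; $N_r^G(v)$ is the set of vertices at distance at most $r$ from $v$ in $G$; the radius of a connected graph $X$ is $\min_{u\in V(X)}\max_{v\in V(X)}\mathrm{dist}^X(u,v)$. An $r$-subdivision of $H$ is obtained from $H$ by replacing edges by pairwise internally disjoint paths of length at most $r+1$; $H$ is a topological depth-$r$ minor of $G$ if $G$ contains a $2r$-subdivision of $H$ as a subgraph. With $\epsilon(H)=|E(H)|/|V(H)|$, let $\widetilde\nabla_r(G)$ be the maximum of $\epsilon(H)$ over all topological depth-$r$ minors $H$ of $G$. A class $\mathcal{C}$ is nowhere dense if for all $\epsilon>0$ and all $r\in\mathbb{N}$ there is $n_0$ such that every $n$-vertex graph $G\in\mathcal{C}$ with $n\ge n_0$ satisfies $\widetilde\nabla_r(G)\le n^{\epsilon}$; otherwise it is somewhere dense. An $r$-neighbourhood cover $\mathcal{X}$ of $G$ is a set of connected subgraphs of $G$ (clusters) such that for every $v\in V(G)$ there is $X\in\mathcal{X}$ with $N_r^G(v)\subseteq V(X)$. Its radius is the maximum radius of its clusters, and its degree is the maximum over $v\in V(G)$ of the number of clusters containing $v$. A class $\mathcal{C}$ admits sparse neighbourhood covers if for every $r\in\mathbb{N}$ there exists $c\in\mathbb{N}$ such that for every $\epsilon>0$ there is $n_0\in\mathbb{N}$ such that every $G\in\mathcal{C}$ with $|V(G)|\ge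 n_0$ has an $r$-neighbourhood cover of radius at most $c\cdot r$ and degree at most $|V(G)|^{\epsilon}$. *)

theory Defs
  imports Complex_Main "HOL-Library.Extended_Nat"
begin

section \<open>Finite simple graphs\<close>

datatype 'a ugraph = Ugraph (verts: "'a set") (edges: "'a set set")

definition simple_graph :: "'a ugraph \<Rightarrow> bool" where
  "simple_graph G \<longleftrightarrow> finite (verts G) \<and> (\<forall>e\<in>edges G. e \<subseteq> verts G \<and> card e = 2)"

definition subgraph :: "'a ugraph \<Rightarrow> 'a ugraph \<Rightarrow> bool" where
  "subgraph H G \<longleftrightarrow> simple_graph H \<and> verts H \<subseteq> verts G \<and> edges H \<subseteq> edges G"

text \<open>A path is given by its nonempty list of pairwise distinct vertices.\<close>

definition path_edges :: "'a list \<Rightarrow> 'a set set" where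
  "path_edges p = {{p ! i, p ! Suc i} | i. Suc i < length p}"

definition is_path :: "'a ugraph \<Rightarrow> 'a list \<Rightarrow> bool" where
  "is_path G p \<longleftrightarrow> p \<noteq> [] \<and> distinct p \<and> set p \<subseteq> verts G \<and> path_edges p \<subseteq> edges G"

definition path_length :: "'a list \<Rightarrow> nat" where
  "path_length p = length p - 1"

definition inner_verts :: "'a list \<Rightarrow> 'a set" where
  "inner_verts p = set (butlast (tl p))"

definition paths_between :: "'a ugraph \<Rightarrow> 'a \<Rightarrow> 'a \<Rightarrow> 'a list set" where
  "paths_between G u v = {p. is_path G p \<and> hd p = u \<and> last p = v}"

text \<open>The distance is \<open>\<infinity>\<close> if there is no path.\<close>

definition gdist :: "'a ugraph \<Rightarrow> 'a \<Rightarrow> 'a \<Rightarrow> enat" where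
  "gdist G u v = (INF p\<in>paths_between G u v. enat (path_length p))"

definition nbhd :: "nat \<Rightarrow> 'a ugraph \<Rightarrow> 'a \<Rightarrow> 'a set" where
  "nbhd r G v = {u \<in> verts G. gdist G v u \<le> enat r}"

definition connected_graph :: "'a ugraph \<Rightarrow> bool" where
  "connected_graph G \<longleftrightarrow>
     verts G \<noteq> {} \<and> (\<forall>u\<in>verts G. \<forall>v\<in>verts G. paths_between G u v \<noteq> {})"

definition radius :: "'a ugraph \<Rightarrow> enat" where
  "radius X = Min ((\<lambda>u. Max ((\<lambda>v. gdist X u v) ` verts X)) ` verts X)"


section \<open>Topological shallow minors and nowhere density\<close>

text \<open>
  \<open>S\<close> is, up to isomorphism, an \<open>r\<close>-subdivision of \<open>H\<close>: the map \<open>f\<close> sends the vertices of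
  \<open>H\<close> to the branch vertices of \<open>S\<close>, and \<open>P e\<close> is the path replacing the edge \<open>e\<close>.
\<close>

definition is_subdivision :: "nat \<Rightarrow> 'b ugraph \<Rightarrow> 'a ugraph \<Rightarrow> bool" where
  "is_subdivision r H S \<longleftrightarrow>
     (\<exists>f P. inj_on f (verts H) \<and>
        (\<forall>e\<in>edges H. is_path S (P e) \<and> {hd (P e), last (P e)} = f ` e \<and>
           path_length (P e) \<le> r + 1 \<and> inner_verts (P e) \<inter> f ` verts H = {}) \<and>
        (\<forall>e\<in>edges H. \<forall>e'\<in>edges H. e \<noteq> e' \<longrightarrow> inner_verts (P e) \<inter> inner_verts (P e') = {}) \<and>
        verts S = f ` verts H \<union> (\<Union>e\<in>edges H. set (P e)) \<and>
        edges S = (\<Union>e\<in>edges H. path_edges (P e)))"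

definition topological_depth_minor :: "nat \<Rightarrow> 'b ugraph \<Rightarrow> 'a ugraph \<Rightarrow> bool" where
  "topological_depth_minor r H G \<longleftrightarrow>
     simple_graph H \<and> (\<exists>S. subgraph S G \<and> is_subdivision (2 * r) H S)"

text \<open>
  The empty graph gets density \<open>0 / 0 = 0\<close>, which does not affect the maximum below.
\<close>

definition edge_density :: "'a ugraph \<Rightarrow> real" where
  "edge_density H = real (card (edges H)) / real (card (verts H))"

text \<open>
  Since the branch vertices of a subdivision lie in \<open>G\<close>, every topological minor of \<open>G\<close> is
  isomorphic to one over the vertex type of \<open>G\<close>, so it suffices to let \<open>H\<close> range over that type.
\<close>

definition top_nabla :: "nat \<Rightarrow> 'a ugraph \<Rightarrow> real" where
  "top_nabla r G = Max {edge_density H | H :: 'a ugraph. topological_depth_minor r H G}"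

definition nowhere_dense :: "'a ugraph set \<Rightarrow> bool" where
  "nowhere_dense C \<longleftrightarrow>
     (\<forall>\<epsilon>::real. \<epsilon> > 0 \<longrightarrow> (\<forall>r::nat. \<exists>n0::nat. \<forall>G\<in>C. card (verts G) \<ge> n0 \<longrightarrow>
        top_nabla r G \<le> real (card (verts G)) powr \<epsilon>))"

definition somewhere_dense :: "'a ugraph set \<Rightarrow> bool" where
  "somewhere_dense C \<longleftrightarrow> \<not> nowhere_dense C"

definition monotone_class :: "'a ugraph set \<Rightarrow> bool" where
  "monotone_class C \<longleftrightarrow> (\<forall>G\<in>C. \<forall>H. subgraph H G \<longrightarrow> H \<in> C)"


section \<open>Neighbourhood covers\<close>

definition neighbourhood_cover :: "nat \<Rightarrow> 'a ugraph \<Rightarrow> 'a ugraph set \<Rightarrow> bool" where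
  "neighbourhood_cover r G \<X> \<longleftrightarrow>
     (\<forall>X\<in>\<X>. subgraph X G \<and> connected_graph X) \<and>
     (\<forall>v\<in>verts G. \<exists>X\<in>\<X>. nbhd r G v \<subseteq> verts X)"

text \<open>
  The two maxima are unspecified only if \<open>G\<close> has no vertices, which the bound \<open>n0\<close> in the
  definition of sparse neighbourhood covers can always exclude.
\<close>

definition cover_radius :: "'a ugraph set \<Rightarrow> enat" where
  "cover_radius \<X> = Max (radius ` \<X>)"

definition cover_degree :: "'a ugraph \<Rightarrow> 'a ugraph set \<Rightarrow> nat" where
  "cover_degree G \<X> = Max ((\<lambda>v. card {X\<in>\<X>. v \<in> verts X}) ` verts G)"

definition admits_sparse_neighbourhood_covers :: "'a ugraph set \<Rightarrow> bool" where
  "admits_sparse_neighbourhood_covers C \<longleftrightarrow>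
     (\<forall>r::nat. \<exists>c::nat. \<forall>\<epsilon>::real. \<epsilon> > 0 \<longrightarrow>
        (\<exists>n0::nat. \<forall>G\<in>C. card (verts G) \<ge> n0 \<longrightarrow>
           (\<exists>\<X>. neighbourhood_cover r G \<X> \<and> cover_radius \<X> \<le> enat (c * r) \<and>
                real (cover_degree G \<X>) \<le> real (card (verts G)) powr \<epsilon>)))"

end

theory Submission
  imports Defs
begin

text \<open>
  Let a graph of the class contain a subdivision of \<open>H\<close> with many edges. Among the vertex sets
  of \<open>H\<close> choose \<open>W\<close> maximizing the number of edges inside \<open>W\<close> divided by
  \<open>|W|\<^sup>1\<^sup>+\<^sup>\<delta>\<close>, and inside \<open>W\<close> a maximal set of edges \<open>F\<close> with degrees at most \<open>D\<close>
  and no cycle of length at most \<open>L + 1\<close>. An edge outside \<open>F\<close> either has a saturated endpoint or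
  joins vertices at distance at most \<open>L\<close> in \<open>F\<close>. There are few pairs of the latter kind, and by
  the choice of \<open>W\<close> a small set cannot meet half of the edges, so linearly many vertices are
  saturated and \<open>F\<close> has average degree of order \<open>D\<close>, a power of \<open>|W|\<close>. In the
  subdivision of \<open>F\<close>, which belongs to the class by monotonicity, the branch vertices of a cluster of
  small radius span at most as many edges of \<open>F\<close> as there are branch vertices in the cluster, while
  every edge of \<open>F\<close> is spanned by some cluster. Hence the degree of the cover is at least the density
  of \<open>F\<close>.
\<close>

lemma finite_family_of_subsets:
  "finite V \<Longrightarrow> (\<And>e. e \<in> E \<Longrightarrow> e \<subseteq> V) \<Longrightarrow> finite E"
  by (rule finite_subset[of _ "Pow V"]) auto

section \<open>Bounded-length walks and girth\<close>

text \<open>Lazy walks: a step may stay in place, so \<open>k\<close> steps stand for a walk of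
  length at most \<open>k\<close>. Vertices may repeat, which lets walks be concatenated
  freely.\<close>

primrec near :: "'a set set \<Rightarrow> nat \<Rightarrow> 'a \<Rightarrow> 'a \<Rightarrow> bool" where
  "near E 0 u v \<longleftrightarrow> u = v"
| "near E (Suc k) u v \<longleftrightarrow> (\<exists>w. near E k u w \<and> (w = v \<or> {w, v} \<in> E))"

lemma near_refl: "near E k u u"
  by (induction k) auto

lemma near_mono_edges: "near E k u v \<Longrightarrow> E \<subseteq> E' \<Longrightarrow> near E' k u v"
  by (induction k arbitrary: v) auto

lemma near_trans: "near E i u v \<Longrightarrow> near E j v w \<Longrightarrow> near E (i + j) u w"
  by (induction j arbitrary: w) auto

lemma near_mono: "near E i u v \<Longrightarrow> i \<le> j \<Longrightarrow> near E j u v"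
  using near_trans[OF _ near_refl, of E i u v "j - i"] by simp

lemma near_edge: "{u, v} \<in> E \<Longrightarrow> near E 1 u v"
  by auto

lemma near_sym: "near E k u v \<Longrightarrow> near E k v u"
proof (induction k arbitrary: v)
  case (Suc k)
  then obtain w where w: "near E k u w" "w = v \<or> {w, v} \<in> E" by auto
  have "near E 1 v w" using w(2) by (auto simp: insert_commute)
  from near_trans[OF this Suc.IH[OF w(1)]] show ?case by simp
qed simp

lemma near_insert:
  assumes "near (insert {x, y} E) n u v"
  shows "near E n u v \<or> (\<exists>i j. i + j + 1 \<le> n \<and>
    (near E i u x \<and> near E j y v \<or> near E i u y \<and> near E j x v))"
  using assms
proof (induction n arbitrary: v)
  case (Suc n)
  then obtain w where w: "near (insert {x, y} E) n u w" "w = v \<or> {w, v} = {x, y} \<or> {w, v} \<in> E"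
    by auto
  from w(2) consider "w = v \<or> {w, v} \<in> E" | "w = x" "v = y" | "w = y" "v = x"
    by (auto simp: doubleton_eq_iff)
  then show ?case
  proof cases
    case 1
    from Suc.IH[OF w(1)] show ?thesis
    proof (elim disjE exE conjE)
      assume "near E n u w"
      then show ?thesis using 1 by auto
    next
      fix i j assume "i + j + 1 \<le> n" "near E i u x" "near E j y w"
      then have "i + Suc j + 1 \<le> Suc n \<and> near E i u x \<and> near E (Suc j) y v" using 1 by auto
      then show ?thesis by blast
    next
      fix i j assume "i + j + 1 \<le> n" "near E i u y" "near E j x w"
      then have "i + Suc j + 1 \<le> Suc n \<and> near E i u y \<and> near E (Suc j) x v" using 1 by auto
      then show ?thesis by blast
    qed
  next
    case 2
    from Suc.IH[OF w(1)] show ?thesis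
    proof (elim disjE exE conjE)
      assume "near E n u w"
      then have "n + 0 + 1 \<le> Suc n \<and> near E n u x \<and> near E 0 y v" using 2 by auto
      then show ?thesis by blast
    next
      fix i j assume "i + j + 1 \<le> n" "near E i u x" "near E j y w"
      then have "i + 0 + 1 \<le> Suc n \<and> near E i u x \<and> near E 0 y v" using 2 by auto
      then show ?thesis by blast
    next
      fix i j assume "i + j + 1 \<le> n" "near E i u y" "near E j x w"
      then show ?thesis using 2 near_mono[of E i u v "Suc n"] by auto
    qed
  next
    case 3
    from Suc.IH[OF w(1)] show ?thesis
    proof (elim disjE exE conjE)
      assume "near E n u w"
      then have "n + 0 + 1 \<le> Suc n \<and> near E n u y \<and> near E 0 x v" using 3 by auto
      then show ?thesis by blast
    next
      fix i j assume "i + j + 1 \<le> n" "near E i u y" "near E j x w"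
      then have "i + 0 + 1 \<le> Suc n \<and> near E i u y \<and> near E 0 x v" using 3 by auto
      then show ?thesis by blast
    next
      fix i j assume "i + j + 1 \<le> n" "near E i u x" "near E j y w"
      then show ?thesis using 3 near_mono[of E i u v "Suc n"] by auto
    qed
  qed
qed simp

text \<open>Every traversed edge has an end reached in fewer than \<open>k\<close> steps. Hence
  edges with both ends at distance at least \<open>k\<close> from \<open>u\<close> can be deleted
  without harm to the walk.\<close>

lemma near_early_edges:
  "near E k u v \<Longrightarrow> near {e \<in> E. \<exists>x\<in>e. \<exists>j<k. near E j u x} k u v"
proof (induction k arbitrary: v)
  case (Suc k)
  then obtain w where w: "near E k u w" "w = v \<or> {w, v} \<in> E" by auto
  have "near {e \<in> E. \<exists>x\<in>e. \<exists>j<Suc k. near E j u x} k u w"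
    by (rule near_mono_edges[OF Suc.IH[OF w(1)]]) (auto intro: less_SucI)
  then show ?case using w by auto
qed simp

text \<open>No cycle has length at most \<open>L + 1\<close>.\<close>

definition girth_gt :: "nat \<Rightarrow> 'a set set \<Rightarrow> bool" where
  "girth_gt L E \<longleftrightarrow> (\<forall>u v. {u, v} \<in> E \<longrightarrow> \<not> near (E - {{u, v}}) L u v)"

text \<open>A short cycle through \<open>{x, y}\<close> itself would join \<open>x\<close> and
  \<open>y\<close> in \<open>E\<close>. A short cycle through an old edge \<open>{u, v}\<close> may
  be taken to use \<open>{x, y}\<close> only once, so the rest of it, including
  \<open>{u, v}\<close>, is again a short walk between \<open>x\<close> and \<open>y\<close> in
  \<open>E\<close>.\<close>

lemma girth_gt_insert:
  assumes "girth_gt L E" "\<not> near E L x y"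
  shows "girth_gt L (insert {x, y} E)"
  unfolding girth_gt_def
proof (intro allI impI notI)
  fix u v assume uv: "{u, v} \<in> insert {x, y} E"
    and near: "near (insert {x, y} E - {{u, v}}) L u v"
  show False
  proof (cases "{u, v} = {x, y}")
    case True
    then have "near E L u v" by (intro near_mono_edges[OF near]) auto
    with True assms(2) near_sym[of E L y x] show False by (auto simp: doubleton_eq_iff)
  next
    case False
    then have E: "{u, v} \<in> E" and "near (insert {x, y} (E - {{u, v}})) L u v"
      using uv near by (auto simp: insert_Diff_if)
    from near_insert[OF this(2)] assms(1) E
    obtain i j where ij: "i + j + 1 \<le> L"
      and *: "near (E - {{u, v}}) i u x \<and> near (E - {{u, v}}) j y v \<or>
        near (E - {{u, v}}) i u y \<and> near (E - {{u, v}}) j x v"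
      unfolding girth_gt_def by blast
    have *: "near E i u x \<and> near E j y v \<or> near E i u y \<and> near E j x v"
      using * near_mono_edges[where E' = E] by blast
    have "near E L x y"
    proof (rule disjE[OF *]; elim conjE)
      assume "near E i u x" "near E j y v"
      then have "near E (i + 1 + j) x y"
        using near_trans[OF near_trans[OF near_sym near_edge[OF E]] near_sym] by blast
      then show ?thesis by (rule near_mono) (use ij in simp)
    next
      assume "near E i u y" "near E j x v"
      then have "near E (i + 1 + j) y x"
        using near_trans[OF near_trans[OF near_sym near_edge[OF E]] near_sym] by blast
      then have "near E L y x" by (rule near_mono) (use ij in simp)
      then show ?thesis by (rule near_sym)
    qed
    with assms(2) show False ..
  qed
qed

text \<open>A step from a given vertex has at most \<open>D + 1\<close> targets, the vertex itself
  included; this multiplies along \<open>k\<close> steps.\<close>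

lemma near_card_le:
  assumes "finite F" "\<And>v. card {e \<in> F. v \<in> e} \<le> D"
  shows "finite {v. near F k u v} \<and> card {v. near F k u v} \<le> (D + 1) ^ k"
proof (induction k)
  case (Suc k)
  let ?N = "\<lambda>w. insert w {v. {w, v} \<in> F}"
  have N: "finite (?N w) \<and> card (?N w) \<le> D + 1" for w
  proof -
    have inj: "inj_on (\<lambda>v. {w, v}) {v. {w, v} \<in> F}"
      by (auto simp: inj_on_def doubleton_eq_iff)
    have sub: "(\<lambda>v. {w, v}) ` {v. {w, v} \<in> F} \<subseteq> {e \<in> F. w \<in> e}" by auto
    have fin: "finite {e \<in> F. w \<in> e}" using assms(1) by simp
    have "finite {v. {w, v} \<in> F}"
      using finite_subset[OF sub fin] inj by (rule finite_imageD)
    moreover have "card {v. {w, v} \<in> F} \<le> D"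
      using card_inj_on_le[OF inj sub fin] assms(2)[of w] by simp
    ultimately show ?thesis by (simp add: card_insert_if)
  qed
  have eq: "{v. near F (Suc k) u v} = (\<Union>w\<in>{v. near F k u v}. ?N w)"
    by auto
  have "card (\<Union>w\<in>{v. near F k u v}. ?N w) \<le> (\<Sum>w\<in>{v. near F k u v}. card (?N w))"
    using Suc.IH by (intro card_UN_le) auto
  also have "\<dots> \<le> (\<Sum>w\<in>{v. near F k u v}. D + 1)"
    using N by (intro sum_mono) auto
  also have "\<dots> \<le> (D + 1) ^ k * (D + 1)"
    using Suc.IH by (simp only: sum_constant of_nat_id mult_le_mono1)
  finally show ?case unfolding eq using Suc.IH N by (auto simp: mult.commute)
qed simp

text \<open>
  Each edge inside \<open>U\<close> joins an endpoint to its parent in a breadth-first search tree rooted at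
  \<open>u\<^sub>0\<close>: otherwise the two tree paths to its endpoints would close a short cycle.
\<close>

lemma girth_card_edges_le:
  assumes "girth_gt (2 * k) F" "finite U" "\<And>v. v \<in> U \<Longrightarrow> near F k u0 v"
    and F: "\<And>e. e \<in> F \<Longrightarrow> card e = 2"
  shows "card {e \<in> F. e \<subseteq> U} \<le> card U"
proof -
  define d where "d v = (LEAST k. near F k u0 v)" for v
  define par where "par v = (SOME w. near F (d v - 1) u0 w \<and> {w, v} \<in> F)" for v
  have d_le: "d v \<le> j" if "near F j u0 v" for v j
    unfolding d_def by (rule Least_le) (rule that)
  have key: "{u, v} \<in> (\<lambda>v. {par v, v}) ` U"
    if e: "{u, v} \<in> F" and U: "u \<in> U" "v \<in> U" and le: "d u \<le> d v" for u v
  proof -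
    have d: "near F (d w) u0 w" "d w \<le> k" if "w \<in> U" for w
      using assms(3)[OF that] LeastI[of "\<lambda>k. near F k u0 w"] d_le by (auto simp: d_def)
    have ne: "u \<noteq> v" using F[OF e] by auto
    \<comment> \<open>Both ends of \<open>{u, v}\<close> are at distance at least \<open>d u\<close>
      from \<open>u0\<close>, so walks of at most \<open>d u\<close> steps from \<open>u0\<close>
      can do without this edge.\<close>
    have avoid: "near (F - {{u, v}}) j u0 w" if "near F j u0 w" "j \<le> d u" for j w
    proof -
      have "{u, v} \<notin> {e \<in> F. \<exists>x\<in>e. \<exists>i<j. near F i u0 x}"
        using that(2) le d_le by fastforce
      then show ?thesis by (intro near_mono_edges[OF near_early_edges[OF that(1)]]) auto
    qed
    have "d v \<noteq> 0" using d(1)[OF U(1)] d(1)[OF U(2)] le ne by (cases "d v") auto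
    then obtain b where b: "d v = Suc b" by (cases "d v") auto
    obtain w where w: "near F b u0 w" "w = v \<or> {w, v} \<in> F"
      using d(1)[OF U(2)] b by auto
    have "w \<noteq> v" using d_le[OF w(1)] b by auto
    with w b have "\<exists>w. near F (d v - 1) u0 w \<and> {w, v} \<in> F" by auto
    then have "near F (d v - 1) u0 (par v) \<and> {par v, v} \<in> F"
      unfolding par_def by (rule someI_ex)
    then have par: "near F b u0 (par v)" "{par v, v} \<in> F" using b by auto
    \<comment> \<open>By this bound \<open>b\<close> is at most \<open>d u\<close>, so the walk to
      the parent avoids \<open>{u, v}\<close> as well.\<close>
    have "d v \<le> d u + 1"
      using d(1)[OF U(1)] e by (intro d_le) auto
    then have "near (F - {{u, v}}) b u0 (par v)"
      using avoid[OF par(1)] b by simp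
    moreover have "{par v, v} \<noteq> {u, v}" if "par v \<noteq> u"
      using that by (auto simp: doubleton_eq_iff)
    ultimately have "near (F - {{u, v}}) (d v) u0 v" if "par v \<noteq> u"
      using that par(2) b by auto
    moreover have "near (F - {{u, v}}) (d u) u u0"
      by (rule near_sym, rule avoid[OF d(1)[OF U(1)]]) simp
    \<comment> \<open>If the parent were not \<open>u\<close>, going from \<open>u\<close> to
      \<open>u0\<close> and on to \<open>v\<close> would bypass \<open>{u, v}\<close> in at most
      \<open>2 * k\<close> steps.\<close>
    ultimately have "near (F - {{u, v}}) (2 * k) u v" if "par v \<noteq> u"
      using near_mono[OF near_trans, of "F - {{u, v}}" "d u" u u0 "d v" v "2 * k"]
        d(2)[OF U(1)] d(2)[OF U(2)] that by auto
    with assms(1) e have "par v = u" unfolding girth_gt_def by blast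
    with U(2) show ?thesis by auto
  qed
  have "{e \<in> F. e \<subseteq> U} \<subseteq> (\<lambda>v. {par v, v}) ` U"
  proof
    fix e assume e: "e \<in> {e \<in> F. e \<subseteq> U}"
    then obtain u v where "e = {u, v}" using F[of e] by (auto simp: card_2_iff)
    with e key[of u v] key[of v u] show "e \<in> (\<lambda>v. {par v, v}) ` U"
      by (cases "d u \<le> d v") (auto simp: insert_commute)
  qed
  then show ?thesis by (rule surj_card_le[OF assms(2)])
qed

section \<open>Dense subgraphs of high girth\<close>

text \<open>\<open>A\<close> is the set of vertices saturated in a maximal \<open>F\<close>;
  counting incidences bounds its size. An edge missing \<open>A\<close> could be added to
  \<open>F\<close> unless \<open>F\<close> already joins its ends in \<open>L\<close> steps, and
  balls of radius \<open>L\<close> have at most \<open>(D + 1) ^ L\<close> vertices.\<close>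

lemma exists_maximal_high_girth:
  assumes "finite V" and E: "\<And>e. e \<in> E \<Longrightarrow> e \<subseteq> V \<and> card e = 2" and "L \<ge> 1"
  obtains F A where "F \<subseteq> E" "girth_gt L F" "A \<subseteq> V" "D * card A \<le> 2 * card F"
    "card {e \<in> E. e \<inter> A = {}} \<le> card V * (D + 1) ^ L"
proof -
  have finE: "finite E" using assms(1) E by (auto intro: finite_family_of_subsets)
  define Q where "Q F \<longleftrightarrow> F \<subseteq> E \<and> girth_gt L F \<and> (\<forall>v. card {e \<in> F. v \<in> e} \<le> D)" for F
  have "finite (Collect Q)"
    by (rule finite_subset[of _ "Pow E"]) (auto simp: Q_def finE)
  moreover have "Q {}" by (auto simp: Q_def girth_gt_def)
  ultimately obtain F where F: "Q F" and max: "\<And>F'. Q F' \<Longrightarrow> F \<subseteq> F' \<Longrightarrow> F = F'"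
    using finite_has_maximal[of "Collect Q"] by blast
  have FE: "F \<subseteq> E" and girth: "girth_gt L F" and deg: "\<And>v. card {e \<in> F. v \<in> e} \<le> D"
    using F by (auto simp: Q_def)
  have finF: "finite F" using FE finE finite_subset by blast
  define A where "A = {v \<in> V. D \<le> card {e \<in> F. v \<in> e}}"
  have finA: "finite A" using assms(1) by (simp add: A_def)
  have "D * card A = (\<Sum>v\<in>A. D)" by simp
  also have "\<dots> \<le> (\<Sum>v\<in>A. card {e \<in> F. v \<in> e})"
    by (intro sum_mono) (auto simp: A_def)
  also have "\<dots> \<le> (\<Sum>v\<in>V. card {e \<in> F. v \<in> e})"
    using assms(1) by (intro sum_mono2) (auto simp: A_def)
  also have "\<dots> = (\<Sum>e\<in>F. 2)"
  proof (rule sum_multicount_gen[OF assms(1) finF], intro ballI)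
    fix e assume "e \<in> F"
    then have "e \<subseteq> V" "card e = 2" using FE E by auto
    moreover from this have "{v \<in> V. v \<in> e} = e" by auto
    ultimately show "card {v \<in> V. v \<in> e} = 2" by simp
  qed
  finally have sat: "D * card A \<le> 2 * card F" by simp
  have close: "near F L u v" if e: "{u, v} \<in> E" "u \<notin> A" "v \<notin> A" for u v
  proof (rule ccontr)
    assume no: "\<not> near F L u v"
    \<comment> \<open>An edge of \<open>F\<close> would be a walk of length 1, so
      \<open>L \<ge> 1\<close> makes the edge a new one.\<close>
    have nF: "{u, v} \<notin> F" using no near_mono[OF near_edge \<open>L \<ge> 1\<close>, of u v F] by blast
    have uv: "u \<in> V" "v \<in> V" using E[OF e(1)] by auto
    have "card {e \<in> insert {u, v} F. x \<in> e} \<le> D" for x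
    proof (cases "x \<in> {u, v}")
      case True
      then have "card {e \<in> F. x \<in> e} < D" using e uv by (auto simp: A_def)
      moreover have "{e \<in> insert {u, v} F. x \<in> e} = insert {u, v} {e \<in> F. x \<in> e}"
        using True by auto
      ultimately show ?thesis using finF nF by (simp add: card_insert_if)
    next
      case False
      then have "{e \<in> insert {u, v} F. x \<in> e} = {e \<in> F. x \<in> e}" by auto
      then show ?thesis using deg by simp
    qed
    then have "Q (insert {u, v} F)"
      using girth_gt_insert[OF girth no] FE e(1) by (auto simp: Q_def)
    from max[OF this] nF show False by auto
  qed
  have ball: "finite {v. near F L u v}" "card {v. near F L u v} \<le> (D + 1) ^ L" for u
    using near_card_le[OF finF deg] by auto
  have "{e \<in> E. e \<inter> A = {}} \<subseteq> (\<Union>u\<in>V. (\<lambda>v. {u, v}) ` {v. near F L u v})"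
  proof
    fix e assume e: "e \<in> {e \<in> E. e \<inter> A = {}}"
    then obtain u v where uv: "e = {u, v}" using E[of e] by (auto simp: card_2_iff)
    with e have "u \<in> V" "near F L u v" using E[of e] close[of u v] by auto
    with uv show "e \<in> (\<Union>u\<in>V. (\<lambda>v. {u, v}) ` {v. near F L u v})" by blast
  qed
  then have "card {e \<in> E. e \<inter> A = {}} \<le> card (\<Union>u\<in>V. (\<lambda>v. {u, v}) ` {v. near F L u v})"
    using assms(1) ball(1) by (intro card_mono) auto
  also have "\<dots> \<le> (\<Sum>u\<in>V. card ((\<lambda>v. {u, v}) ` {v. near F L u v}))"
    using assms(1) by (rule card_UN_le)
  also have "\<dots> \<le> (\<Sum>u\<in>V. (D + 1) ^ L)"
    using ball by (intro sum_mono) (meson card_image_le le_trans)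
  also have "\<dots> = card V * (D + 1) ^ L" by simp
  finally show ?thesis using that[of F A] FE girth sat by (auto simp: A_def)
qed

section \<open>Edge counts in relatively densest vertex sets\<close>

lemma exists_balanced_colouring:
  assumes "finite V" "K > 0"
  obtains col :: "'a \<Rightarrow> nat" where "\<And>v. col v < K"
    "\<And>i. card {v \<in> V. col v = i} \<le> card V div K + 1"
proof -
  \<comment> \<open>The colour is the position in an enumeration modulo \<open>K\<close>; within one
    colour class the quotient by \<open>K\<close> tells vertices apart.\<close>
  obtain h where h: "bij_betw h V {0..<card V}" using ex_bij_betw_finite_nat[OF assms(1)] ..
  have "card {v \<in> V. h v mod K = i} \<le> card V div K + 1" for i
  proof -
    have "card {v \<in> V. h v mod K = i} \<le> card {0..card V div K}"
    proof (rule card_inj_on_le)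
      show "inj_on (\<lambda>v. h v div K) {v \<in> V. h v mod K = i}"
      proof (rule inj_onI)
        fix x y assume xy: "x \<in> {v \<in> V. h v mod K = i}" "y \<in> {v \<in> V. h v mod K = i}"
          "h x div K = h y div K"
        then have "h x mod K = h y mod K" "h x div K = h y div K" by auto
        then have "h x = h y" by (metis div_mult_mod_eq)
        with xy h show "x = y" by (auto simp: bij_betw_def inj_on_def)
      qed
      show "(\<lambda>v. h v div K) ` {v \<in> V. h v mod K = i} \<subseteq> {0..card V div K}"
        using bij_betwE[OF h] by (fastforce intro: div_le_mono)
    qed simp
    then show ?thesis by simp
  qed
  with that[of "\<lambda>v. h v mod K"] assms(2) show ?thesis by simp
qed

text \<open>
  Splitting \<open>V\<close> into \<open>K\<close> classes, every edge meeting the small set \<open>A\<close> lies in the union of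
  \<open>A\<close> and one class; these unions have few edges by hypothesis.
\<close>

lemma card_edges_meeting_small_set_le:
  fixes M \<delta> :: real
  assumes "finite V" and E: "\<And>e. e \<in> E \<Longrightarrow> e \<subseteq> V \<and> card e = 2"
    and K: "0 < K" "K \<le> card V" and A: "A \<subseteq> V" "card A * K \<le> card V"
    and "\<delta> > 0" "M \<ge> 0"
    and sparse: "\<And>U. U \<subseteq> V \<Longrightarrow> real (card {e \<in> E. e \<subseteq> U}) \<le> M * real (card U) powr (1 + \<delta>)"
  shows "real (card {e \<in> E. e \<inter> A \<noteq> {}}) \<le> K * (M * (3 * card V / K) powr (1 + \<delta>))"
proof -
  obtain col where col: "\<And>v. col v < K"
    "\<And>i. card {v \<in> V. col v = i} \<le> card V div K + 1"
    using exists_balanced_colouring[OF assms(1) K(1)] by metis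
  have finE: "finite E" using assms(1) E by (auto intro: finite_family_of_subsets)
  let ?U = "\<lambda>i. A \<union> {v \<in> V. col v = i}"
  \<comment> \<open>The class is that of the other endpoint \<open>w\<close>, because
    \<open>a\<close> lies in \<open>A\<close> anyway.\<close>
  have sub: "{e \<in> E. e \<inter> A \<noteq> {}} \<subseteq> (\<Union>i\<in>{..<K}. {e \<in> E. e \<subseteq> ?U i})"
  proof
    fix e assume e: "e \<in> {e \<in> E. e \<inter> A \<noteq> {}}"
    then obtain a where a: "a \<in> e" "a \<in> A" by auto
    obtain u v where "e = {u, v}" using e E[of e] by (auto simp: card_2_iff)
    with a obtain w where w: "e = {a, w}" by auto
    then have "e \<subseteq> ?U (col w)" using a e E[of e] by auto
    with col(1) e show "e \<in> (\<Union>i\<in>{..<K}. {e \<in> E. e \<subseteq> ?U i})" by auto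
  qed
  \<comment> \<open>The summands \<open>card A\<close>, \<open>card V div K\<close> and 1 are each
    at most \<open>card V / K\<close>, whence the factor 3.\<close>
  have U: "real (card (?U i)) \<le> 3 * card V / K" for i
  proof -
    have "card (?U i) \<le> card A + (card V div K + 1)"
      using card_Un_le[of A "{v \<in> V. col v = i}"] col(2)[of i] by simp
    then have "card (?U i) * K \<le> (card A + (card V div K + 1)) * K"
      by (rule mult_le_mono1)
    also have "\<dots> = card A * K + (card V div K) * K + K"
      by (simp add: algebra_simps)
    also have "\<dots> \<le> 3 * card V"
      using A(2) K(2) div_times_less_eq_dividend[of "card V" K] by linarith
    finally have "real (card (?U i) * K) \<le> real (3 * card V)"
      by (simp only: of_nat_le_iff)
    then show ?thesis using K(1) by (simp add: field_simps)
  qed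
  have "card {e \<in> E. e \<inter> A \<noteq> {}} \<le> card (\<Union>i\<in>{..<K}. {e \<in> E. e \<subseteq> ?U i})"
    using finE by (intro card_mono[OF _ sub]) auto
  also have "\<dots> \<le> (\<Sum>i\<in>{..<K}. card {e \<in> E. e \<subseteq> ?U i})"
    by (rule card_UN_le) simp
  finally have "real (card {e \<in> E. e \<inter> A \<noteq> {}}) \<le> (\<Sum>i\<in>{..<K}. real (card {e \<in> E. e \<subseteq> ?U i}))"
    by (simp only: of_nat_sum[symmetric] of_nat_le_iff)
  also have "\<dots> \<le> (\<Sum>i\<in>{..<K}. M * (3 * card V / K) powr (1 + \<delta>))"
  proof (rule sum_mono)
    fix i
    have "real (card {e \<in> E. e \<subseteq> ?U i}) \<le> M * real (card (?U i)) powr (1 + \<delta>)"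
      using A(1) by (intro sparse) auto
    also have "\<dots> \<le> M * (3 * card V / K) powr (1 + \<delta>)"
      using U[of i] assms(7,8) by (intro mult_left_mono powr_mono2) auto
    finally show "real (card {e \<in> E. e \<subseteq> ?U i}) \<le> M * (3 * card V / K) powr (1 + \<delta>)" .
  qed
  finally show ?thesis by simp
qed

text \<open>There are finitely many nonempty candidates, so the quotient attains a maximum. With the
  denominator cleared, the comparison covers the empty set too.\<close>

lemma exists_densest_subset:
  fixes \<delta> :: real
  assumes "finite V" "V \<noteq> {}" and E: "\<And>e. e \<in> E \<Longrightarrow> card e = 2"
  obtains W where "W \<subseteq> V" "W \<noteq> {}"
    "\<And>U. U \<subseteq> V \<Longrightarrow> real (card {e \<in> E. e \<subseteq> U})
       \<le> card {e \<in> E. e \<subseteq> W} / card W powr (1 + \<delta>) * real (card U) powr (1 + \<delta>)"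
proof -
  let ?g = "\<lambda>U. card {e \<in> E. e \<subseteq> U} / card U powr (1 + \<delta>)"
  let ?S = "Pow V - {{}}"
  have S: "finite ?S" "?S \<noteq> {}" using assms(1,2) by auto
  have "Max (?g ` ?S) \<in> ?g ` ?S" using S by (intro Max_in) auto
  then obtain W where W0: "W \<in> ?S" "?g W = Max (?g ` ?S)" by (metis (no_types, lifting) imageE)
  have W: "?g U \<le> ?g W" if "U \<in> ?S" for U
    unfolding W0(2) using S(1) that by (intro Max_ge) auto
  show ?thesis
  proof (rule that[of W])
    fix U assume U: "U \<subseteq> V"
    show "real (card {e \<in> E. e \<subseteq> U}) \<le> ?g W * real (card U) powr (1 + \<delta>)"
    proof (cases "U = {}")
      case True
      then have "{e \<in> E. e \<subseteq> U} = {}" using E by fastforce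
      then show ?thesis by (simp only: card.empty) simp
    next
      case False
      then have "card U > 0" using U assms(1) by (simp add: card_gt_0_iff finite_subset)
      then have "real (card U) powr (1 + \<delta>) > 0" by simp
      moreover have "?g U \<le> ?g W" using U False by (intro W) auto
      ultimately show ?thesis by (simp only: pos_divide_le_eq)
    qed
  qed (use W0(1) in auto)
qed

lemma card_edges_le_square:
  assumes "finite V" "\<And>e. e \<in> E \<Longrightarrow> e \<subseteq> V \<and> card e = 2"
  shows "card E \<le> card V ^ 2"
proof -
  have "E \<subseteq> (\<lambda>(u, v). {u, v}) ` (V \<times> V)"
  proof
    fix e assume "e \<in> E"
    then have e: "e \<subseteq> V" "card e = 2" using assms(2) by auto
    then obtain u v where "e = {u, v}" by (auto simp: card_2_iff)
    with e(1) show "e \<in> (\<lambda>(u, v). {u, v}) ` (V \<times> V)" by auto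
  qed
  then have "card E \<le> card (V \<times> V)" by (rule surj_card_le[rotated]) (use assms(1) in simp)
  then show ?thesis by (simp only: card_cartesian_product power2_eq_square)
qed

text \<open>
  \<open>W\<close> is chosen relatively densest, which rules out that few vertices saturated at degree
  \<open>D\<close> meet half of the edges inside \<open>W\<close>. The degree bound may depend on the unknown size
  of \<open>W\<close>.
\<close>

lemma exists_dense_high_girth:
  fixes \<delta> x :: real and D :: "nat \<Rightarrow> nat"
  assumes "finite V" "V \<noteq> {}" and E: "\<And>e. e \<in> E \<Longrightarrow> e \<subseteq> V \<and> card e = 2"
    and "\<delta> > 0" "L \<ge> 1" "K > 0" and K: "2 * 3 powr (1 + \<delta>) < real K powr \<delta>"
    and dense: "x * real (card V) powr (1 + \<delta>) \<le> real (card E)" and "x \<ge> 1"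
    and D: "\<And>m. x \<le> real m \<Longrightarrow> K \<le> m \<and> 2 * real ((D m + 1) ^ L) \<le> real m powr \<delta>"
  obtains W F where "W \<subseteq> V" "F \<subseteq> {e \<in> E. e \<subseteq> W}" "girth_gt L F" "x \<le> real (card W)"
    "D (card W) * card W \<le> 2 * K * card F"
proof -
  obtain W where W: "W \<subseteq> V" "W \<noteq> {}"
    and sparse: "\<And>U. U \<subseteq> V \<Longrightarrow> real (card {e \<in> E. e \<subseteq> U})
       \<le> card {e \<in> E. e \<subseteq> W} / card W powr (1 + \<delta>) * real (card U) powr (1 + \<delta>)"
    by (rule exists_densest_subset[OF assms(1,2), where E = E and \<delta> = \<delta>]) (use E in auto)
  define EW where "EW = {e \<in> E. e \<subseteq> W}"
  define m where "m = card W"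
  define M where "M = real (card EW) / real m powr (1 + \<delta>)"
  have finW: "finite W" using W(1) assms(1) finite_subset by blast
  have EW: "e \<subseteq> W \<and> card e = 2" if "e \<in> EW" for e using that E by (auto simp: EW_def)
  have finEW: "finite EW"
    using finW EW by (auto intro: finite_family_of_subsets)
  have m: "m > 0" using W(2) finW by (simp add: m_def card_gt_0_iff)
  have cardEW: "real (card EW) = M * real m powr (1 + \<delta>)" using m by (simp add: M_def)
  \<comment> \<open>Comparison with \<open>U = V\<close>: the relative density \<open>M\<close> of
    \<open>W\<close> is at least that of the whole graph, hence at least \<open>x\<close>.\<close>
  have "{e \<in> E. e \<subseteq> V} = E" using E by auto
  then have "x * real (card V) powr (1 + \<delta>) \<le> M * real (card V) powr (1 + \<delta>)"
    using sparse[of V] dense by (simp only: M_def EW_def m_def) simp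
  moreover have "real (card V) powr (1 + \<delta>) > 0"
    using assms(1,2) by (simp add: card_gt_0_iff)
  ultimately have xM: "x \<le> M" by simp
  have EW_le: "card EW \<le> m ^ 2"
    unfolding m_def using finW EW by (rule card_edges_le_square)
  \<comment> \<open>The trivial bound \<open>m ^ 2\<close> on the number of edges yields
    \<open>M \<le> m\<close>, so a large density forces \<open>W\<close> to be large.\<close>
  have "M * real m powr (1 + \<delta>) \<le> real (m ^ 2)"
    unfolding cardEW[symmetric] using EW_le by (simp only: of_nat_le_iff)
  also have "\<dots> = real m * real m powr 1" using m by (simp add: power2_eq_square)
  also have "\<dots> \<le> real m * real m powr (1 + \<delta>)"
    using m \<open>\<delta> > 0\<close> by (intro mult_left_mono powr_mono) auto
  finally have "M \<le> real m" using m by simp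
  with xM have xm: "x \<le> real m" by simp
  obtain F A where F: "F \<subseteq> EW" "girth_gt L F" and A: "A \<subseteq> W" "D m * card A \<le> 2 * card F"
    and rest: "card {e \<in> EW. e \<inter> A = {}} \<le> m * (D m + 1) ^ L"
    by (rule exists_maximal_high_girth[OF finW EW \<open>L \<ge> 1\<close>, where D = "D m", folded m_def])
  have "D m * m \<le> 2 * K * card F"
  proof (rule ccontr)
    \<comment> \<open>Then at most a fraction \<open>1 / K\<close> of \<open>W\<close> is saturated.
      It follows that fewer than half of the edges meet \<open>A\<close> and at most half miss it,
      which is absurd.\<close>
    assume "\<not> D m * m \<le> 2 * K * card F"
    then have "K * (2 * card F) < D m * m" by simp
    moreover have "K * (D m * card A) \<le> K * (2 * card F)" using A(2) by (rule mult_le_mono2)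
    moreover have "K * (D m * card A) = D m * (card A * K)" by simp
    ultimately have "D m * (card A * K) < D m * m" by linarith
    then have AK: "card A * K \<le> m" by simp
    have "real (card {e \<in> EW. e \<inter> A \<noteq> {}}) \<le> K * (M * (3 * m / K) powr (1 + \<delta>))"
      unfolding m_def
    proof (rule card_edges_meeting_small_set_le[OF finW EW \<open>K > 0\<close> _ A(1) _ \<open>\<delta> > 0\<close>])
      show "K \<le> card W" using D[OF xm] by (simp add: m_def)
      show "card A * K \<le> card W" using AK by (simp add: m_def)
      show "M \<ge> 0" using xM \<open>x \<ge> 1\<close> by simp
      fix U assume "U \<subseteq> W"
      then have "{e \<in> EW. e \<subseteq> U} = {e \<in> E. e \<subseteq> U}" by (auto simp: EW_def)
      then show "real (card {e \<in> EW. e \<subseteq> U}) \<le> M * real (card U) powr (1 + \<delta>)"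
        using sparse[of U] \<open>U \<subseteq> W\<close> W(1) by (simp only: M_def EW_def m_def)
    qed
    \<comment> \<open>Splitting into \<open>K\<close> parts costs a factor \<open>K\<close>, but
      each part gains \<open>K powr (1 + \<delta>)\<close>; the net gain
      \<open>K powr \<delta>\<close> exceeds \<open>2 * 3 powr (1 + \<delta>)\<close> by the choice
      of \<open>K\<close>.\<close>
    also have "\<dots> = M * real m powr (1 + \<delta>) * (3 powr (1 + \<delta>) / K powr \<delta>)"
      using \<open>K > 0\<close> m by (simp add: powr_divide powr_mult powr_add)
    also have "\<dots> < M * real m powr (1 + \<delta>) * (1 / 2)"
    proof (rule mult_strict_left_mono)
      show "3 powr (1 + \<delta>) / K powr \<delta> < 1 / 2"
        using K \<open>K > 0\<close> by (simp add: field_simps)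
      show "0 < M * real m powr (1 + \<delta>)" using xM \<open>x \<ge> 1\<close> m by simp
    qed
    finally have meet: "real (card {e \<in> EW. e \<inter> A \<noteq> {}}) < real (card EW) / 2"
      using cardEW by simp
    have "real (card {e \<in> EW. e \<inter> A = {}}) \<le> real (m * (D m + 1) ^ L)"
      using rest by (simp only: of_nat_le_iff)
    also have "\<dots> \<le> real m * (real m powr \<delta> / 2)"
      unfolding of_nat_mult using D[OF xm] by (intro mult_left_mono) auto
    also have "\<dots> = 1 * real m powr (1 + \<delta>) / 2" using m by (simp add: powr_add)
    also have "\<dots> \<le> M * real m powr (1 + \<delta>) / 2"
      using xM \<open>x \<ge> 1\<close> by (intro divide_right_mono mult_right_mono) auto
    finally have miss: "real (card {e \<in> EW. e \<inter> A = {}}) \<le> real (card EW) / 2"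
      using cardEW by simp
    have "EW = {e \<in> EW. e \<inter> A \<noteq> {}} \<union> {e \<in> EW. e \<inter> A = {}}" by auto
    then have "card EW = card ({e \<in> EW. e \<inter> A \<noteq> {}} \<union> {e \<in> EW. e \<inter> A = {}})"
      by (rule arg_cong)
    also have "\<dots> \<le> card {e \<in> EW. e \<inter> A \<noteq> {}} + card {e \<in> EW. e \<inter> A = {}}"
      by (rule card_Un_le)
    finally have "real (card EW) \<le> real (card {e \<in> EW. e \<inter> A \<noteq> {}}) + real (card {e \<in> EW. e \<inter> A = {}})"
      by (simp only: of_nat_add[symmetric] of_nat_le_iff)
    with meet miss show False by simp
  qed
  with F xm W(1) show ?thesis by (intro that[of W F]) (auto simp: EW_def m_def)
qed

section \<open>Neighbourhood covers of subdivisions\<close>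

lemma near_path:
  assumes "is_path X p"
  shows "near (edges X) (path_length p) (hd p) (last p)"
proof -
  have "near (edges X) i (p ! 0) (p ! i)" if "i < length p" for i
    using that
  proof (induction i)
    case (Suc i)
    then have "{p ! i, p ! Suc i} \<in> edges X"
      using assms by (auto simp: is_path_def path_edges_def)
    with Suc show ?case by auto
  qed simp
  from this[of "length p - 1"] assms show ?thesis
    by (simp add: is_path_def path_length_def hd_conv_nth last_conv_nth)
qed

lemma near_if_gdist_le:
  assumes "gdist X u v \<le> enat k"
  shows "near (edges X) k u v"
proof -
  \<comment> \<open>A strict bound on the infimum yields a path below it directly.\<close>
  have "gdist X u v < enat (Suc k)" using assms by (simp add: le_less_trans)
  then obtain p where p: "p \<in> paths_between X u v" "path_length p < Suc k"
    unfolding gdist_def INF_less_iff by auto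
  then have "near (edges X) (path_length p) u v"
    using near_path[of X p] by (auto simp: paths_between_def)
  then show ?thesis by (rule near_mono) (use p(2) in simp)
qed

lemma radius_le_imp_centre:
  assumes "simple_graph X" "verts X \<noteq> {}" "radius X \<le> enat k"
  obtains x where "x \<in> verts X" "\<And>v. v \<in> verts X \<Longrightarrow> gdist X x v \<le> enat k"
proof -
  let ?ecc = "\<lambda>u. Max (gdist X u ` verts X)"
  have fin: "finite (verts X)" using assms(1) by (simp add: simple_graph_def)
  have "Min (?ecc ` verts X) \<in> ?ecc ` verts X" using fin assms(2) by (intro Min_in) auto
  then obtain x where x: "x \<in> verts X" "radius X = ?ecc x"
    unfolding radius_def by (metis (no_types, lifting) imageE)
  have "gdist X x v \<le> enat k" if "v \<in> verts X" for v
  proof -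
    have "gdist X x v \<le> ?ecc x" using that fin by (intro Max_ge) auto
    with x(2) assms(3) show ?thesis by simp
  qed
  with x(1) show ?thesis by (rule that)
qed

section \<open>Subdivisions with fixed branch vertices and paths\<close>

lemma set_path_eq: "p \<noteq> [] \<Longrightarrow> set p = {hd p, last p} \<union> inner_verts p"
  unfolding inner_verts_def
  by (cases p; cases "tl p" rule: rev_cases) (auto simp: butlast_append)

lemma path_edge_subset: "e \<in> path_edges p \<Longrightarrow> e \<subseteq> set p"
  by (auto simp: path_edges_def)

text \<open>\<open>f\<close> and \<open>P\<close> are parameters so that a subgraph of
  \<open>H\<close> can be subdivided with the same branch map and the same paths.\<close>

locale subdivision =
  fixes q :: nat and H :: "'b ugraph" and S :: "'a ugraph"
    and f :: "'b \<Rightarrow> 'a" and P :: "'b set \<Rightarrow> 'a list"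
  assumes simple_H: "simple_graph H" and simple_S: "simple_graph S"
    and inj: "inj_on f (verts H)"
    and path: "e \<in> edges H \<Longrightarrow> is_path S (P e)"
    and ends: "e \<in> edges H \<Longrightarrow> {hd (P e), last (P e)} = f ` e"
    and path_length: "e \<in> edges H \<Longrightarrow> path_length (P e) \<le> q + 1"
    and inner_branch: "e \<in> edges H \<Longrightarrow> inner_verts (P e) \<inter> f ` verts H = {}"
    and inner_disjoint: "e \<in> edges H \<Longrightarrow> e' \<in> edges H \<Longrightarrow> e \<noteq> e' \<Longrightarrow>
      inner_verts (P e) \<inter> inner_verts (P e') = {}"
    and verts_S: "verts S = f ` verts H \<union> (\<Union>e\<in>edges H. set (P e))"
    and edges_S: "edges S = (\<Union>e\<in>edges H. path_edges (P e))"

lemma is_subdivisionE: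
  assumes "simple_graph H" "simple_graph S" "is_subdivision q H S"
  obtains f P where "subdivision q H S f P"
proof -
  from assms(3) obtain f P where inj: "inj_on f (verts H)"
    and path: "\<forall>e\<in>edges H. is_path S (P e) \<and> {hd (P e), last (P e)} = f ` e \<and>
      path_length (P e) \<le> q + 1 \<and> inner_verts (P e) \<inter> f ` verts H = {}"
    and disj: "\<forall>e\<in>edges H. \<forall>e'\<in>edges H. e \<noteq> e' \<longrightarrow> inner_verts (P e) \<inter> inner_verts (P e') = {}"
    and verts: "verts S = f ` verts H \<union> (\<Union>e\<in>edges H. set (P e))"
    and edges: "edges S = (\<Union>e\<in>edges H. path_edges (P e))"
    unfolding is_subdivision_def by (elim exE conjE)
  have "subdivision q H S f P"
    by (rule subdivision.intro[OF assms(1,2) inj _ _ _ _ _ verts edges])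
      (simp_all only: path[rule_format] disj[rule_format] not_False_eq_True)
  then show ?thesis by (rule that)
qed

context subdivision
begin

lemma edge_H: "e \<in> edges H \<Longrightarrow> e \<subseteq> verts H \<and> card e = 2"
  using simple_H by (simp add: simple_graph_def)

lemma set_P: "e \<in> edges H \<Longrightarrow> set (P e) = f ` e \<union> inner_verts (P e)"
  using path[of e] ends[of e] set_path_eq[of "P e"] by (auto simp: is_path_def)

lemma branch_on_path:
  assumes "e \<in> edges H" "v \<in> verts H" "f v \<in> set (P e)"
  shows "v \<in> e"
proof -
  have "f v \<in> f ` e" using assms set_P inner_branch by blast
  then show ?thesis using assms(1,2) edge_H inj by (blast dest: inj_onD)
qed

text \<open>
  A walk ending inside the path of \<open>e\<close> entered it through an endpoint of \<open>e\<close> at least one step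
  earlier.
\<close>

lemma near_projection_aux:
  assumes u: "u \<in> verts H" and "near (edges S) k (f u) z"
  shows "(\<forall>v\<in>verts H. z = f v \<longrightarrow> near (edges H) k u v) \<and>
    (\<forall>e\<in>edges H. z \<in> inner_verts (P e) \<longrightarrow> (\<exists>a\<in>e. \<exists>j<k. near (edges H) j u a))"
  using assms(2)
proof (induction k arbitrary: z)
  case 0
  then show ?case using inj u inner_branch by (auto dest: inj_onD)
next
  case (Suc k)
  then obtain y where y: "near (edges S) k (f u) y" "y = z \<or> {y, z} \<in> edges S" by auto
  note branch = conjunct1[OF Suc.IH[OF y(1)], rule_format]
  note inner = conjunct2[OF Suc.IH[OF y(1)], rule_format]
  show ?case
  proof (cases "y = z")
    case True
    have "near (edges H) (Suc k) u v" if "v \<in> verts H" "z = f v" for v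
      by (rule near_mono[OF branch]) (use that True in auto)
    with True inner show ?thesis by (blast intro: less_SucI)
  next
    case False
    then obtain e where e: "e \<in> edges H" "{y, z} \<in> path_edges (P e)"
      using y(2) edges_S by auto
    have yz: "y \<in> set (P e)" "z \<in> set (P e)" using path_edge_subset[OF e(2)] by auto
    have y_cases: "(\<exists>w\<in>e. y = f w) \<or> y \<in> inner_verts (P e)"
      using yz(1) set_P[OF e(1)] by auto
    have eV: "e \<subseteq> verts H" using edge_H[OF e(1)] by simp
    show ?thesis
    proof (intro conjI ballI impI)
      fix v assume v: "v \<in> verts H" "z = f v"
      have ve: "v \<in> e" using branch_on_path[OF e(1) v(1)] yz(2) v(2) by simp
      \<comment> \<open>Two ends of \<open>e\<close> are equal or adjacent in \<open>H\<close>, so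
        traversing the path of \<open>e\<close> counts as one step.\<close>
      have step: "near (edges H) (Suc j) u v" if "near (edges H) j u a" "a \<in> e" for a j
      proof -
        have "a = v \<or> {a, v} = e"
          using edge_H[OF e(1)] that(2) ve by (auto simp: card_2_iff)
        then show ?thesis using that(1) e(1) by auto
      qed
      from y_cases show "near (edges H) (Suc k) u v"
      proof
        assume "\<exists>w\<in>e. y = f w"
        then obtain w where "w \<in> e" "near (edges H) k u w" using branch eV by blast
        then show ?thesis using step by blast
      next
        assume "y \<in> inner_verts (P e)"
        then obtain a j where "a \<in> e" "j < k" "near (edges H) j u a" using inner e(1) by blast
        then show ?thesis using step[of j a] near_mono[of "edges H" "Suc j" u v "Suc k"] by simp
      qed
    next
      fix e' assume e': "e' \<in> edges H" "z \<in> inner_verts (P e')"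
      \<comment> \<open>An inner vertex is no branch vertex and lies on one path only, so the last
        step of the walk runs along the path of \<open>e'\<close>.\<close>
      have "z \<notin> f ` e" using inner_branch[OF e'(1)] e'(2) eV by blast
      then have "z \<in> inner_verts (P e)" using yz(2) set_P[OF e(1)] by blast
      then have "e' = e" using inner_disjoint[OF e(1) e'(1)] e'(2) by blast
      from y_cases show "\<exists>a\<in>e'. \<exists>j<Suc k. near (edges H) j u a"
      proof
        assume "\<exists>w\<in>e. y = f w"
        then show ?thesis using branch eV \<open>e' = e\<close> by blast
      next
        assume "y \<in> inner_verts (P e)"
        then show ?thesis using inner e(1) \<open>e' = e\<close> less_SucI by blast
      qed
    qed
  qed
qed

lemma near_projection:
  "u \<in> verts H \<Longrightarrow> v \<in> verts H \<Longrightarrow> near (edges S) k (f u) (f v) \<Longrightarrow> near (edges H) k u v"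
  using near_projection_aux by blast

text \<open>The branch vertices of a cluster are within \<open>2 * R\<close> steps of each other in
  \<open>S\<close>, via the centre, and by projection in \<open>H\<close>; the girth then allows at
  most as many edges as branch vertices. Summing over clusters counts each branch vertex at most
  \<open>cover_degree\<close> times.\<close>

lemma card_edges_le_cover_degree:
  assumes girth: "girth_gt (4 * R) (edges H)"
    and cover: "neighbourhood_cover (q + 1) S \<X>" "cover_radius \<X> \<le> enat R"
  shows "card (edges H) \<le> card (verts H) * cover_degree S \<X>"
proof (cases "verts H = {}")
  case True
  then have "edges H = {}" using edge_H by fastforce
  then show ?thesis by simp
next
  case nonempty: False
  have finV: "finite (verts H)" and finS: "finite (verts S)"
    using simple_H simple_S by (auto simp: simple_graph_def)
  have finE: "finite (edges H)"
    using finV edge_H by (auto intro: finite_family_of_subsets)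
  have finES: "finite (edges S)"
    using simple_S by (auto simp: simple_graph_def intro: finite_family_of_subsets)
  have sub: "subgraph X S" "connected_graph X" if "X \<in> \<X>" for X
    using that cover(1) by (auto simp: neighbourhood_cover_def)
  \<comment> \<open>Clusters are subgraphs of a finite graph, so there are finitely many; this makes
    \<open>cover_radius\<close> a genuine maximum.\<close>
  have "\<X> \<subseteq> (\<lambda>(V, E). Ugraph V E) ` (Pow (verts S) \<times> Pow (edges S))"
  proof
    fix X assume "X \<in> \<X>"
    then have "(verts X, edges X) \<in> Pow (verts S) \<times> Pow (edges S)"
      using sub(1)[of X] by (auto simp: subgraph_def)
    then show "X \<in> (\<lambda>(V, E). Ugraph V E) ` (Pow (verts S) \<times> Pow (edges S))"
      by (rule rev_image_eqI) simp
  qed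
  then have finX: "finite \<X>" by (rule finite_subset) (use finS finES in simp)
  define B where "B X = {v \<in> verts H. f v \<in> verts X}" for X :: "'a ugraph"
  define EB where "EB X = {e \<in> edges H. e \<subseteq> B X}" for X :: "'a ugraph"
  have cluster: "card (EB X) \<le> card (B X)" if X: "X \<in> \<X>" for X
  proof (cases "B X = {}")
    case True
    then have "EB X = {}" using edge_H by (fastforce simp: EB_def)
    then show ?thesis by simp
  next
    case False
    then obtain u0 where u0: "u0 \<in> B X" by auto
    have "radius X \<le> cover_radius \<X>"
      unfolding cover_radius_def using X finX by (intro Max_ge) auto
    then have "radius X \<le> enat R" using cover(2) by simp
    moreover have "simple_graph X" "verts X \<noteq> {}"
      using sub[OF X] by (auto simp: subgraph_def connected_graph_def)
    ultimately obtain x where x: "\<And>v. v \<in> verts X \<Longrightarrow> gdist X x v \<le> enat R"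
      using radius_le_imp_centre by metis
    have x: "near (edges S) R x v" if "v \<in> verts X" for v
      by (rule near_mono_edges[OF near_if_gdist_le[OF x[OF that]]])
        (use sub(1)[OF X] in \<open>simp add: subgraph_def\<close>)
    have "near (edges H) (2 * R) u0 v" if "v \<in> B X" for v
    proof (rule near_projection)
      show "near (edges S) (2 * R) (f u0) (f v)"
        using near_trans[OF near_sym[OF x] x, of "f u0" "f v"] u0 that
        by (simp add: B_def mult_2)
    qed (use u0 that in \<open>auto simp: B_def\<close>)
    \<comment> \<open>The search depth is \<open>2 * R\<close>, which accounts for
      \<open>4 * R\<close> in the girth hypothesis.\<close>
    then show ?thesis
      unfolding EB_def
      by (intro girth_card_edges_le[where k = "2 * R" and ?u0.0 = u0])
        (use girth finV edge_H in \<open>auto simp: B_def\<close>)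
  qed
  \<comment> \<open>The path of \<open>e\<close> has length at most \<open>q + 1\<close>, so the
    cluster covering the ball around its first vertex contains both ends.\<close>
  have "edges H \<subseteq> (\<Union>X\<in>\<X>. EB X)"
  proof
    fix e assume e: "e \<in> edges H"
    have p: "P e \<noteq> []" "set (P e) \<subseteq> verts S" using path[OF e] by (auto simp: is_path_def)
    then have hd: "hd (P e) \<in> verts S" and last: "last (P e) \<in> verts S" by auto
    from hd obtain X where X: "X \<in> \<X>" "nbhd (q + 1) S (hd (P e)) \<subseteq> verts X"
      using cover(1) by (auto simp: neighbourhood_cover_def)
    have "[hd (P e)] \<in> paths_between S (hd (P e)) (hd (P e))"
      using hd by (auto simp: paths_between_def is_path_def path_edges_def)
    then have "gdist S (hd (P e)) (hd (P e)) \<le> enat (path_length [hd (P e)])"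
      unfolding gdist_def by (rule INF_lower)
    also have "\<dots> \<le> enat (q + 1)" by (simp add: path_length_def)
    finally have 1: "hd (P e) \<in> verts X" using X hd by (auto simp: nbhd_def)
    have "P e \<in> paths_between S (hd (P e)) (last (P e))"
      using path[OF e] by (simp add: paths_between_def)
    then have "gdist S (hd (P e)) (last (P e)) \<le> enat (path_length (P e))"
      unfolding gdist_def by (rule INF_lower)
    also have "\<dots> \<le> enat (q + 1)" using path_length[OF e] by simp
    finally have "last (P e) \<in> verts X" using X last by (auto simp: nbhd_def)
    with 1 have "f ` e \<subseteq> verts X" unfolding ends[OF e, symmetric] by simp
    then have "e \<in> EB X" using e edge_H[OF e] by (auto simp: EB_def B_def)
    with X(1) show "e \<in> (\<Union>X\<in>\<X>. EB X)" by blast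
  qed
  then have "card (edges H) \<le> card (\<Union>X\<in>\<X>. EB X)"
    using finX finE by (intro card_mono) (auto simp: EB_def)
  also have "\<dots> \<le> (\<Sum>X\<in>\<X>. card (EB X))" using finX by (rule card_UN_le)
  also have "\<dots> \<le> (\<Sum>X\<in>\<X>. card {v \<in> verts H. f v \<in> verts X})"
    using cluster by (intro sum_mono) (simp add: B_def)
  also have "\<dots> = (\<Sum>v\<in>verts H. card {X \<in> \<X>. f v \<in> verts X})"
    by (rule sum_multicount_gen[OF finX finV]) simp
  also have "\<dots> \<le> (\<Sum>v\<in>verts H. cover_degree S \<X>)"
  proof (rule sum_mono)
    fix v assume "v \<in> verts H"
    then have "f v \<in> verts S" using verts_S by auto
    then show "card {X \<in> \<X>. f v \<in> verts X} \<le> cover_degree S \<X>"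
      unfolding cover_degree_def using finS by (intro Max_ge) auto
  qed
  finally show ?thesis by simp
qed

text \<open>A path of length at most \<open>q + 1\<close> has at most \<open>q + 2\<close> vertices.
  The upper bound keeps the order of \<open>S\<close> polynomial in that of
  \<open>H\<close>.\<close>

lemma card_verts_bounds:
  "card (verts H) \<le> card (verts S)"
  "card (verts S) \<le> card (verts H) + (q + 2) * card (edges H)"
proof -
  have finV: "finite (verts H)" and finS: "finite (verts S)"
    using simple_H simple_S by (auto simp: simple_graph_def)
  have finE: "finite (edges H)"
    using finV edge_H by (auto intro: finite_family_of_subsets)
  show "card (verts H) \<le> card (verts S)"
    using inj finS verts_S by (intro card_inj_on_le) auto
  have "card (set (P e)) \<le> q + 2" if "e \<in> edges H" for e
    using path_length[OF that] card_length[of "P e"] by (simp add: path_length_def)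
  then have "(\<Sum>e\<in>edges H. card (set (P e))) \<le> (\<Sum>e\<in>edges H. q + 2)"
    by (intro sum_mono)
  moreover have "card (\<Union>e\<in>edges H. set (P e)) \<le> (\<Sum>e\<in>edges H. card (set (P e)))"
    using finE by (rule card_UN_le)
  moreover have "card (f ` verts H) \<le> card (verts H)" using finV by (rule card_image_le)
  moreover have "card (verts S) \<le> card (f ` verts H) + card (\<Union>e\<in>edges H. set (P e))"
    unfolding verts_S by (rule card_Un_le)
  ultimately show "card (verts S) \<le> card (verts H) + (q + 2) * card (edges H)"
    by (simp add: mult.commute)
qed

lemma exists_subdivision_of_subgraph:
  assumes "subgraph H' H"
  obtains S' where "subgraph S' S" "subdivision q H' S' f P"
proof -
  define S' where "S' = Ugraph (f ` verts H' \<union> (\<Union>e\<in>edges H'. set (P e)))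
    (\<Union>e\<in>edges H'. path_edges (P e))"
  have H': "simple_graph H'" "verts H' \<subseteq> verts H" "edges H' \<subseteq> edges H"
    using assms by (auto simp: subgraph_def)
  have V: "verts S' \<subseteq> verts S" and E: "edges S' \<subseteq> edges S"
    unfolding verts_S edges_S S'_def using H' by auto
  have simple: "simple_graph S'"
    unfolding simple_graph_def
  proof (intro conjI ballI)
    show "finite (verts S')" using V simple_S by (auto simp: simple_graph_def intro: finite_subset)
    fix e assume e: "e \<in> edges S'"
    then show "card e = 2" using E simple_S by (auto simp: simple_graph_def)
    from e show "e \<subseteq> verts S'" using path_edge_subset by (fastforce simp: S'_def)
  qed
  show ?thesis
  proof (rule that[of S'])
    show "subgraph S' S" using V E simple by (simp add: subgraph_def)
    show "subdivision q H' S' f P"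
    proof
      show "inj_on f (verts H')" using inj H'(2) by (rule inj_on_subset)
      fix e assume e: "e \<in> edges H'"
      then have eH: "e \<in> edges H" using H'(3) by auto
      show "is_path S' (P e)" using path[OF eH] e by (auto simp: is_path_def S'_def)
      show "{hd (P e), last (P e)} = f ` e" by (rule ends[OF eH])
      show "path_length (P e) \<le> q + 1" by (rule path_length[OF eH])
      show "inner_verts (P e) \<inter> f ` verts H' = {}" using inner_branch[OF eH] H'(2) by blast
      show "inner_verts (P e) \<inter> inner_verts (P e') = {}" if "e' \<in> edges H'" "e \<noteq> e'" for e'
        using inner_disjoint eH that H'(3) by blast
    qed (use simple H' in \<open>simp_all add: S'_def\<close>)
  qed
qed

end

section \<open>Somewhere dense classes\<close>

lemma card_verts_subgraph_le:
  "simple_graph G \<Longrightarrow> subgraph H G \<Longrightarrow> card (verts H) \<le> card (verts G)"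
  by (auto simp: subgraph_def simple_graph_def intro: card_mono)

text \<open>\<open>Max\<close> is informative only on a finite nonempty set: the densities are
  quotients of bounded natural numbers, and the empty graph is a minor.\<close>

lemma less_top_nablaE:
  fixes G :: "'a ugraph"
  assumes "simple_graph G" "x < top_nabla r G"
  obtains H :: "'a ugraph" and S f P where "subdivision (2 * r) H S f P" "subgraph S G"
    "x < edge_density H"
proof -
  have minorE: "\<exists>S f P. subdivision (2 * r) H S f P \<and> subgraph S G"
    if "topological_depth_minor r H G" for H :: "'a ugraph"
    using that unfolding topological_depth_minor_def
    by (metis is_subdivisionE subgraph_def)
  let ?D = "{edge_density H | H :: 'a ugraph. topological_depth_minor r H G}"
  let ?N = "card (verts G)"
  have "?D \<subseteq> (\<lambda>(e, v). real e / real v) ` ({..?N ^ 2} \<times> {..?N})"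
  proof clarify
    fix H :: "'a ugraph" assume "topological_depth_minor r H G"
    then obtain S f P where S: "subdivision (2 * r) H S f P" "subgraph S G"
      using minorE by blast
    have H: "simple_graph H" using S(1) by (simp add: subdivision_def)
    have v: "card (verts H) \<le> ?N"
      using subdivision.card_verts_bounds(1)[OF S(1)] card_verts_subgraph_le[OF assms(1) S(2)]
      by simp
    have "card (edges H) \<le> card (verts H) ^ 2"
      by (rule card_edges_le_square) (use H in \<open>auto simp: simple_graph_def\<close>)
    also have "\<dots> \<le> ?N ^ 2" using v by (rule power_mono) simp
    finally have "(card (edges H), card (verts H)) \<in> {..?N ^ 2} \<times> {..?N}" using v by simp
    then show "edge_density H \<in> (\<lambda>(e, v). real e / real v) ` ({..?N ^ 2} \<times> {..?N})"
      by (rule rev_image_eqI) (simp add: edge_density_def)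
  qed
  then have "finite ?D" by (rule finite_subset) simp
  moreover have "?D \<noteq> {}"
  proof -
    have "topological_depth_minor r (Ugraph {} {} :: 'a ugraph) G"
      unfolding topological_depth_minor_def is_subdivision_def subgraph_def simple_graph_def
      by (auto intro!: exI[of _ "Ugraph {} {}"])
    then show ?thesis by blast
  qed
  ultimately have "top_nabla r G \<in> ?D" unfolding top_nabla_def by (rule Max_in)
  then obtain H :: "'a ugraph" where "topological_depth_minor r H G" "top_nabla r G = edge_density H"
    by blast
  with minorE[of H] assms(2) that show ?thesis by auto
qed

section \<open>Growth of powers and choice of the degree bound\<close>

lemma eventually_less_powr:
  fixes b c :: real
  assumes "b > 0"
  shows "\<forall>\<^sub>F m in sequentially. c < real m powr b"
proof -
  have "c < real m powr b" if "nat \<lceil>max c 1 powr (1 / b)\<rceil> + 1 \<le> m" for m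
  proof -
    have "max c 1 powr (1 / b) < real m" using that by linarith
    then have "(max c 1 powr (1 / b)) powr b < real m powr b"
      using assms by (intro powr_less_mono2) auto
    then show ?thesis using assms by (simp add: powr_powr)
  qed
  then show ?thesis by (rule eventually_sequentiallyI)
qed

text \<open>As \<open>a * L = \<delta> / 2\<close>, the ball bound grows like
  \<open>m powr (\<delta> / 2)\<close>, leaving an equal power to absorb constants. The term
  \<open>c * m ^ 2\<close> is to bound the order of the subdivided graph; its power
  \<open>a / 4\<close> grows like \<open>m powr (a / 2)\<close>, slower than the degree
  bound.\<close>

lemma exists_degree_threshold:
  fixes \<delta> a c :: real and K L :: nat
  assumes "\<delta> > 0" "L \<ge> 1" "c \<ge> 0" and a: "a = \<delta> / (2 * real L)"
  obtains m0 where "\<And>m. m0 \<le> m \<Longrightarrow> K \<le> m \<and> 2 * real ((nat \<lfloor>real m powr a\<rfloor> + 1) ^ L) \<le> real m powr \<delta> \<and>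
    2 * K * (c * real m ^ 2) powr (a / 4) < real (nat \<lfloor>real m powr a\<rfloor>)"
proof -
  have a0: "a > 0" and aL: "a * real L = \<delta> / 2" using assms by simp_all
  have "\<forall>\<^sub>F m in sequentially. K \<le> m \<and> 1 \<le> m \<and> 2 ^ Suc L < real m powr (\<delta> / 2) \<and>
    4 * K * c powr (a / 4) < real m powr (a / 2)"
    using assms(1) a0 by (intro eventually_conj eventually_less_powr eventually_ge_at_top) auto
  then obtain m0 where m0: "\<And>m. m0 \<le> m \<Longrightarrow> K \<le> m \<and> 1 \<le> m \<and> 2 ^ Suc L < real m powr (\<delta> / 2) \<and>
    4 * K * c powr (a / 4) < real m powr (a / 2)"
    unfolding eventually_sequentially by blast
  show ?thesis
  proof (rule that[of m0], intro conjI)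
    fix m assume "m0 \<le> m"
    note m = m0[OF this]
    show "K \<le> m" using m by simp
    let ?D = "nat \<lfloor>real m powr a\<rfloor>"
    have ge1: "1 \<le> real m powr a" using m a0 by (intro ge_one_powr_ge_zero) auto
    then have "real ?D \<le> real m powr a" by (simp add: of_nat_nat)
    then have "real (?D + 1) \<le> 2 * real m powr a" using ge1 by linarith
    then have "real (?D + 1) ^ L \<le> (2 * real m powr a) ^ L" by (rule power_mono) simp
    also have "\<dots> = 2 ^ L * real m powr (\<delta> / 2)"
      unfolding aL[symmetric] using m by (simp add: power_mult_distrib powr_power mult.commute)
    finally have "2 * real ((?D + 1) ^ L) \<le> 2 ^ Suc L * real m powr (\<delta> / 2)" by simp
    also have "\<dots> \<le> real m powr (\<delta> / 2) * real m powr (\<delta> / 2)"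
      using m by (intro mult_right_mono) auto
    also have "\<dots> = real m powr \<delta>" by (simp add: powr_add[symmetric])
    finally show "2 * real ((?D + 1) ^ L) \<le> real m powr \<delta>" .
    have "1 \<le> real ?D" using ge1 le_nat_floor[of 1 "real m powr a"] by simp
    moreover have "real m powr a < real ?D + 1" using ge1 by linarith
    ultimately have D: "real m powr a < 2 * real ?D" by linarith
    have "(real m ^ 2) powr (a / 4) = (real m powr 2) powr (a / 4)" using m by simp
    also have "\<dots> = real m powr (a / 2)" unfolding powr_powr by simp
    finally have "4 * K * (c * real m ^ 2) powr (a / 4) = 4 * K * c powr (a / 4) * real m powr (a / 2)"
      by (simp only: powr_mult mult.assoc)
    also have "\<dots> < real m powr (a / 2) * real m powr (a / 2)"
      using m by (intro mult_strict_right_mono) auto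
    also have "\<dots> = real m powr a" by (simp add: powr_add[symmetric])
    also note D
    finally show "2 * K * (c * real m ^ 2) powr (a / 4) < real ?D" by simp
  qed
qed

theorem theorem8:
  fixes C :: "'a ugraph set"
  assumes "\<forall>G\<in>C. simple_graph G"
    and "monotone_class C"
    and "somewhere_dense C"
  shows "\<not> admits_sparse_neighbourhood_covers C"
proof
  assume sparse: "admits_sparse_neighbourhood_covers C"
  obtain \<epsilon> r where \<epsilon>: "\<epsilon> > 0" and dense: "\<And>n0. \<exists>G\<in>C. card (verts G) \<ge> n0 \<and>
      real (card (verts G)) powr \<epsilon> < top_nabla r G"
    using assms(3) unfolding somewhere_dense_def nowhere_dense_def by (auto simp: not_le)
  define q where "q = 2 * r"
  \<comment> \<open>The cover radius \<open>q + 1\<close> is the maximal length of a subdivision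
    path. It is essential that \<open>c\<close> precedes the exponent: \<open>c\<close> determines
    \<open>L\<close>, and the exponent \<open>a / 4\<close> used below depends on
    \<open>L\<close>.\<close>
  obtain c where c: "\<And>\<epsilon>::real. \<epsilon> > 0 \<Longrightarrow> \<exists>n0. \<forall>G\<in>C. card (verts G) \<ge> n0 \<longrightarrow>
      (\<exists>\<X>. neighbourhood_cover (q + 1) G \<X> \<and> cover_radius \<X> \<le> enat (c * (q + 1)) \<and>
        real (cover_degree G \<X>) \<le> real (card (verts G)) powr \<epsilon>)"
    using sparse unfolding admits_sparse_neighbourhood_covers_def by metis
  define R L where "R = c * (q + 1)" and "L = 4 * R + 1"
  \<comment> \<open>The exponent \<open>\<epsilon>\<close> is split in half: one half for the
    superlinear density in \<open>H\<close>, the other for the factor \<open>x\<close>, which makes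
    \<open>W\<close> large.\<close>
  define \<delta> a where "\<delta> = \<epsilon> / 2" and "a = \<delta> / (2 * real L)"
  have \<delta>: "\<delta> > 0" and L: "L \<ge> 1" using \<epsilon> by (auto simp: \<delta>_def L_def)
  have a: "a > 0" using \<delta> L by (simp add: a_def)
  obtain K where K: "K > 0" "2 * 3 powr (1 + \<delta>) < real K powr \<delta>"
    using eventually_happens'[OF sequentially_bot
        eventually_conj[OF eventually_gt_at_top[of 0] eventually_less_powr[OF \<delta>]]]
    by blast
  obtain m0 where m0: "\<And>m. m0 \<le> m \<Longrightarrow> K \<le> m \<and> 2 * real ((nat \<lfloor>real m powr a\<rfloor> + 1) ^ L) \<le> real m powr \<delta> \<and>
      2 * K * (real (q + 3) * real m ^ 2) powr (a / 4) < real (nat \<lfloor>real m powr a\<rfloor>)"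
    by (rule exists_degree_threshold[OF \<delta> L _ a_def, of "real (q + 3)" K]) auto
  obtain n1 where n1: "\<And>G. G \<in> C \<Longrightarrow> card (verts G) \<ge> n1 \<Longrightarrow>
      \<exists>\<X>. neighbourhood_cover (q + 1) G \<X> \<and> cover_radius \<X> \<le> enat R \<and>
        real (cover_degree G \<X>) \<le> real (card (verts G)) powr (a / 4)"
    using c[of "a / 4"] a unfolding R_def by auto
  \<comment> \<open>\<open>W\<close> will have at least \<open>n powr \<delta>\<close> vertices and
    thus pass both thresholds \<open>m0\<close> and \<open>n1\<close>.\<close>
  obtain n2 where n2: "\<And>n. n2 \<le> n \<Longrightarrow> real (max m0 n1) < real n powr \<delta>"
    using eventually_less_powr[OF \<delta>] unfolding eventually_sequentially by blast
  obtain G where G: "G \<in> C" "max n2 1 \<le> card (verts G)"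
    "real (card (verts G)) powr \<epsilon> < top_nabla r G"
    using dense by blast
  define n where "n = card (verts G)"
  define x where "x = real n powr \<delta>"
  have simple_G: "simple_graph G" using assms(1) G(1) by simp
  obtain H :: "'a ugraph" and S f P where sub: "subdivision q H S f P" "subgraph S G"
    and H: "real n powr \<epsilon> < edge_density H"
    unfolding q_def n_def by (rule less_top_nablaE[OF simple_G G(3)])
  have simple_H: "simple_graph H" using sub(1) by (simp add: subdivision_def)
  have h: "card (verts H) \<noteq> 0"
  proof
    assume "card (verts H) = 0"
    then have "edge_density H = 0" by (simp add: edge_density_def)
    with H show False by (simp add: not_less)
  qed
  have hn: "card (verts H) \<le> n"
    using subdivision.card_verts_bounds(1)[OF sub(1)] card_verts_subgraph_le[OF simple_G sub(2)]
    by (simp add: n_def)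
  have n1': "1 \<le> n" using G(2) by (simp add: n_def)
  have "x * real (card (verts H)) powr (1 + \<delta>)
      = x * real (card (verts H)) powr \<delta> * real (card (verts H))"
    using h by (simp add: powr_add)
  also have "\<dots> \<le> x * real n powr \<delta> * real (card (verts H))"
    using hn \<delta> by (intro mult_right_mono mult_left_mono powr_mono2) (auto simp: x_def)
  also have "\<dots> = real n powr \<epsilon> * real (card (verts H))"
    by (simp add: x_def powr_add[symmetric] \<delta>_def)
  also have "\<dots> \<le> real (card (edges H))"
    using H h by (simp add: edge_density_def field_simps)
  finally have dense_H: "x * real (card (verts H)) powr (1 + \<delta>) \<le> real (card (edges H))" .
  have x1: "x \<ge> 1" unfolding x_def using n1' \<delta> by (intro ge_one_powr_ge_zero) auto
  have x_large: "real (max m0 n1) < x" unfolding x_def using G(2) by (intro n2) (simp add: n_def)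
  have finV: "finite (verts H)" using simple_H by (simp add: simple_graph_def)
  obtain W F where W: "W \<subseteq> verts H" and F: "F \<subseteq> {e \<in> edges H. e \<subseteq> W}"
    and girth: "girth_gt L F" and xW: "x \<le> real (card W)"
    and DF: "nat \<lfloor>real (card W) powr a\<rfloor> * card W \<le> 2 * K * card F"
  proof (rule exists_dense_high_girth[OF finV _ _ \<delta> L K dense_H x1,
      where D = "\<lambda>m. nat \<lfloor>real m powr a\<rfloor>"])
    show "verts H \<noteq> {}" using h by auto
    show "e \<subseteq> verts H \<and> card e = 2" if "e \<in> edges H" for e
      using that simple_H by (simp add: simple_graph_def)
    show "K \<le> m \<and> 2 * real ((nat \<lfloor>real m powr a\<rfloor> + 1) ^ L) \<le> real m powr \<delta>"
      if "x \<le> real m" for m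
      using m0[of m] that x_large by simp
  qed blast
  define m where "m = card W"
  have m: "m0 \<le> m" "n1 \<le> m" "1 \<le> m" using xW x_large x1 by (auto simp: m_def)
  let ?H = "Ugraph W F"
  have F2: "e \<subseteq> W \<and> card e = 2" if "e \<in> F" for e
    using that F simple_H by (auto simp: simple_graph_def)
  have finW: "finite W" using W finV finite_subset by blast
  have "subgraph ?H H"
    using W F F2 finW by (auto simp: subgraph_def simple_graph_def)
  then obtain T where T: "subgraph T S" "subdivision q ?H T f P"
    by (rule subdivision.exists_subdivision_of_subgraph[OF sub(1)])
  have "subgraph T G" using T(1) sub(2) by (auto simp: subgraph_def)
  then have TC: "T \<in> C" using assms(2) G(1) by (auto simp: monotone_class_def)
  define N where "N = card (verts T)"
  have mN: "m \<le> N" and N: "N \<le> m + (q + 2) * card F"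
    using subdivision.card_verts_bounds[OF T(2)] by (auto simp: m_def N_def)
  \<comment> \<open>The order of \<open>T\<close> is polynomial in \<open>m\<close> regardless of
    the size of \<open>G\<close>, so the cover degree is bounded by a small power of
    \<open>m\<close>.\<close>
  have "card F \<le> m ^ 2" unfolding m_def using finW F2 by (rule card_edges_le_square)
  then have "(q + 2) * card F \<le> (q + 2) * m ^ 2" by (rule mult_le_mono2)
  moreover have "m \<le> m ^ 2" using m(3) by (simp add: power2_eq_square)
  ultimately have "N \<le> (q + 3) * m ^ 2" using N by (simp add: algebra_simps)
  then have N: "real N \<le> real (q + 3) * real m ^ 2"
    by (metis of_nat_le_iff of_nat_mult of_nat_power)
  have "n1 \<le> card (verts T)" using m(2) mN by (simp add: N_def)
  from n1[OF TC this] obtain \<X> where cover: "neighbourhood_cover (q + 1) T \<X>"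
    "cover_radius \<X> \<le> enat R" and deg: "real (cover_degree T \<X>) \<le> real N powr (a / 4)"
    unfolding N_def by blast
  have "girth_gt (4 * R) F"
    using girth near_mono[of _ "4 * R" _ _ L] unfolding girth_gt_def L_def by auto
  then have "card F \<le> m * cover_degree T \<X>"
    using subdivision.card_edges_le_cover_degree[OF T(2) _ cover] by (simp add: m_def)
  \<comment> \<open>Combining both bounds on \<open>card F\<close> and cancelling \<open>m\<close>
    puts the degree bound below \<open>2 * K\<close> times the cover degree, against the choice of
    \<open>m0\<close>.\<close>
  then have "2 * K * card F \<le> 2 * K * (m * cover_degree T \<X>)" by (rule mult_le_mono2)
  with DF have "nat \<lfloor>real m powr a\<rfloor> * m \<le> 2 * K * (m * cover_degree T \<X>)"
    unfolding m_def by (rule le_trans)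
  also have "\<dots> = (2 * K * cover_degree T \<X>) * m" by (simp only: ac_simps)
  finally have "nat \<lfloor>real m powr a\<rfloor> * m \<le> (2 * K * cover_degree T \<X>) * m" .
  then have "nat \<lfloor>real m powr a\<rfloor> \<le> 2 * K * cover_degree T \<X>" using m(3) by simp
  then have "real (nat \<lfloor>real m powr a\<rfloor>) \<le> real (2 * K * cover_degree T \<X>)"
    by (simp only: of_nat_le_iff)
  also have "\<dots> \<le> 2 * K * real N powr (a / 4)" using deg by (simp add: mult_left_mono)
  also have "\<dots> \<le> 2 * K * (real (q + 3) * real m ^ 2) powr (a / 4)"
    using N a by (intro mult_left_mono powr_mono2) auto
  also have "\<dots> < real (nat \<lfloor>real m powr a\<rfloor>)" using m0[OF m(1)] by simp
  finally show False by simp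
qed

end
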